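(* Let $H$ be a real square-integrable kernel on $\Omega_s\times\Omega_t$, i.e. $\|H\|=\left(\int_{\Omega_s}\int_{\Omega_t}H(s,t)^2\,dt\,ds\right)^{1/2}<\infty$. Let $c$ be a bounded function on $\Omega_s$ and $\ell$ a bounded function on $\Omega_t$ such that, for some constants $c_0>0$ and $\ell_0>0$, $c(s)>c_0$ for all $s\in\Omega_s$ and $|\ell(t)|>\ell_0$ for all $t\in\Omega_t$. Then the weighted kernel $$\tilde H(s,t)=\frac{H(s,t)}{c(s)\,\ell(t)}$$ is square integrable on $\Omega_s\times\Omega_t$.
   Context: $\Omega_s$ and $\Omega_t$ are the domains of the variables $s$ and $t$ of the kernel $H$ of a Fredholm integral equation of the first kind $\int_{\Omega_t}H(s,t)f(t)\,dt=g(s)$. All functions are real-valued and (implicitly) measurable. *)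

theory Defs
  imports "HOL-Analysis.Analysis"
begin

text \<open>
  The \<open>L\<^sup>2\<close> norm of a real kernel on \<open>S \<times> T\<close>, the square root of the iterated Lebesgue integral
  of \<open>H\<^sup>2\<close> over \<open>T\<close> and then \<open>S\<close>.  The integrals are integrals of nonnegative functions with values
  in \<open>[0, \<infinity>]\<close>, so that finiteness of the norm is a genuine condition (the Bochner integral would
  return 0 for a non-integrable function).  The library has no square root on \<^typ>\<open>ennreal\<close>, so
  the value \<open>\<infinity>\<close> is treated separately.
\<close>

definition kernel_norm ::
  "'a::euclidean_space set \<Rightarrow> 'b::euclidean_space set \<Rightarrow> ('a \<Rightarrow> 'b \<Rightarrow> real) \<Rightarrow> ennreal"
where
  "kernel_norm S T H =
     (let I = (\<integral>\<^sup>+ s. (\<integral>\<^sup>+ t. ennreal ((H s t)\<^sup>2) \<partial>lebesgue_on T) \<partial>lebesgue_on S)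
      in if I = \<infinity> then \<infinity> else ennreal (sqrt (enn2real I)))"

text \<open>
  Joint measurability is taken with respect to Lebesgue measure on the product space, i.e. the
  completion of the product of the two Lebesgue measures.
\<close>

definition square_integrable_kernel ::
  "'a::euclidean_space set \<Rightarrow> 'b::euclidean_space set \<Rightarrow> ('a \<Rightarrow> 'b \<Rightarrow> real) \<Rightarrow> bool"
where
  "square_integrable_kernel S T H \<longleftrightarrow>
     (\<lambda>(s, t). H s t) \<in> borel_measurable (lebesgue_on (S \<times> T)) \<and> kernel_norm S T H < \<infinity>"

end

theory Submission
  imports Defs
begin

text \<open>
  On \<open>\<Omega>\<^sub>s \<times> \<Omega>\<^sub>t\<close> the weight \<open>c(s) l(t)\<close> exceeds \<open>c\<^sub>0 l\<^sub>0\<close> in absolute value, so the weighted kernel is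
  pointwise at most \<open>\<bar>H\<bar> / (c\<^sub>0 l\<^sub>0)\<close>, and its square integral is at most \<open>1 / (c\<^sub>0 l\<^sub>0)\<^sup>2\<close> times that
  of \<open>H\<close>.  Two points need care.

  First, \<open>H\<close> is measurable only for the Lebesgue \<open>\<sigma>\<close>-algebra of the product space, so a section
  \<open>H(s, \<cdot>)\<close> need be measurable only for almost every \<open>s\<close>.  The constant must therefore be pulled out
  of the iterated integral without measurability of the integrands; lemma \<open>nn_integral_cmult_le\<close>
  does this straight from the definition of the integral as a supremum over simple functions.

  Second, the weights are only Lebesgue measurable, and measurability of \<open>(s, t) \<mapsto> c(s) l(t)\<close> on
  the product requires that the projections pull Lebesgue measurable sets (not just Borel sets)
  back to Lebesgue measurable sets.  They do, because the preimage of a null set is a cylinder over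
  that set and hence again null (\<open>lebesgue_measurable_fst\<close>, \<open>lebesgue_measurable_snd\<close>).
\<close>

lemma lebesgue_measurable_fst:
  "fst \<in> measurable (lebesgue :: ('a::euclidean_space \<times> 'b::euclidean_space) measure) lebesgue"
proof (rule completion.measurable_completion2)
  show fst_lborel: "fst \<in> measurable (lebesgue :: ('a \<times> 'b) measure) lborel"
    by (intro measurable_completion) (simp add: borel_prod[symmetric])
  show "null_sets lborel \<subseteq> null_sets (distr (lebesgue :: ('a \<times> 'b) measure) lborel fst)"
  proof
    fix A :: "'a set"
    assume A: "A \<in> null_sets lborel"
    then have "A \<times> (UNIV::'b set) \<in> null_sets (lborel \<Otimes>\<^sub>M lborel)"
      by (intro lborel.times_in_null_sets1) auto
    then have "A \<times> (UNIV::'b set) \<in> null_sets lebesgue"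
      unfolding lborel_prod by (rule null_sets_completionI)
    moreover have "fst -` A = A \<times> (UNIV::'b set)"
      by auto
    ultimately show "A \<in> null_sets (distr (lebesgue :: ('a \<times> 'b) measure) lborel fst)"
      using A fst_lborel by (auto simp: null_sets_distr_iff dest: null_setsD2)
  qed
qed

lemma lebesgue_measurable_snd:
  "snd \<in> measurable (lebesgue :: ('a::euclidean_space \<times> 'b::euclidean_space) measure) lebesgue"
proof (rule completion.measurable_completion2)
  show snd_lborel: "snd \<in> measurable (lebesgue :: ('a \<times> 'b) measure) lborel"
    by (intro measurable_completion) (simp add: borel_prod[symmetric])
  show "null_sets lborel \<subseteq> null_sets (distr (lebesgue :: ('a \<times> 'b) measure) lborel snd)"
  proof
    fix A :: "'b set"
    assume A: "A \<in> null_sets lborel"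
    then have "(UNIV::'a set) \<times> A \<in> null_sets (lborel \<Otimes>\<^sub>M lborel)"
      by (intro lborel.times_in_null_sets2) auto
    then have "(UNIV::'a set) \<times> A \<in> null_sets lebesgue"
      unfolding lborel_prod by (rule null_sets_completionI)
    moreover have "snd -` A = (UNIV::'a set) \<times> A"
      by auto
    ultimately show "A \<in> null_sets (distr (lebesgue :: ('a \<times> 'b) measure) lborel snd)"
      using A snd_lborel by (auto simp: null_sets_distr_iff dest: null_setsD2)
  qed
qed

text \<open>
  For measurable \<open>f\<close> this is half of \<open>nn_integral_cmult\<close>.  It survives for arbitrary \<open>f\<close> because
  a simple function below \<open>k f\<close> becomes, after division by the finite nonzero \<open>k\<close>, a simple function
  below \<open>f\<close>.
\<close>

lemma nn_integral_cmult_le: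
  fixes k :: ennreal
  assumes k: "k \<noteq> 0" "k \<noteq> \<infinity>"
  shows "(\<integral>\<^sup>+ x. k * f x \<partial>M) \<le> k * (\<integral>\<^sup>+ x. f x \<partial>M)"
  unfolding nn_integral_def[of M "\<lambda>x. k * f x"]
proof (rule SUP_least, clarify)
  fix g
  assume g: "simple_function M g" "g \<le> (\<lambda>x. k * f x)"
  have k_inverse: "k * inverse k = 1"
    using k by (metis divide_ennreal_def ennreal_divide_self infinity_ennreal_def less_top
        not_gr_zero)
  have scaled: "simple_function M (\<lambda>x. inverse k * g x)"
    using g(1) by (rule simple_function_compose1)
  have below: "inverse k * g x \<le> f x" for x
  proof -
    have "inverse k * g x \<le> inverse k * (k * f x)"
      using g(2) by (intro mult_left_mono) (auto simp: le_fun_def)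
    also have "\<dots> = f x"
      using k_inverse by (metis mult.assoc mult.commute mult_1)
    finally show ?thesis .
  qed
  have "integral\<^sup>S M g = (\<integral>\<^sup>S x. k * (inverse k * g x) \<partial>M)"
    using k_inverse by (simp add: mult.assoc[symmetric])
  also have "\<dots> = k * (\<integral>\<^sup>S x. inverse k * g x \<partial>M)"
    by (rule simple_integral_mult[OF scaled])
  also have "\<dots> = k * (\<integral>\<^sup>+ x. inverse k * g x \<partial>M)"
    by (simp add: nn_integral_eq_simple_integral[OF scaled])
  also have "\<dots> \<le> k * integral\<^sup>N M f"
    by (intro mult_left_mono nn_integral_mono below) auto
  finally show "integral\<^sup>S M g \<le> k * integral\<^sup>N M f" .
qed

lemma kernel_norm_finite_iff:
  "kernel_norm S T H < \<infinity> \<longleftrightarrow>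
    (\<integral>\<^sup>+ s. (\<integral>\<^sup>+ t. ennreal ((H s t)\<^sup>2) \<partial>lebesgue_on T) \<partial>lebesgue_on S) < \<infinity>"
  by (auto simp: kernel_norm_def Let_def less_top)

lemma kernel_norm_finite_dominated:
  assumes H: "kernel_norm S T H < \<infinity>"
    and "K > 0"
    and G: "\<And>s t. s \<in> S \<Longrightarrow> t \<in> T \<Longrightarrow> \<bar>G s t\<bar> \<le> K * \<bar>H s t\<bar>"
  shows "kernel_norm S T G < \<infinity>"
proof -
  let ?k = "ennreal (K\<^sup>2)"
  have k: "?k \<noteq> 0" "?k \<noteq> \<infinity>"
    using \<open>K > 0\<close> by auto
  have pointwise: "ennreal ((G s t)\<^sup>2) \<le> ?k * ennreal ((H s t)\<^sup>2)" if "s \<in> S" "t \<in> T" for s t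
  proof -
    have "\<bar>G s t\<bar>\<^sup>2 \<le> (K * \<bar>H s t\<bar>)\<^sup>2"
      using G[OF that] by (intro power_mono) auto
    then show ?thesis
      by (simp add: ennreal_mult[symmetric] power_mult_distrib)
  qed
  have inner: "(\<integral>\<^sup>+ t. ennreal ((G s t)\<^sup>2) \<partial>lebesgue_on T)
      \<le> ?k * (\<integral>\<^sup>+ t. ennreal ((H s t)\<^sup>2) \<partial>lebesgue_on T)" if "s \<in> S" for s
  proof -
    have "(\<integral>\<^sup>+ t. ennreal ((G s t)\<^sup>2) \<partial>lebesgue_on T)
        \<le> (\<integral>\<^sup>+ t. ?k * ennreal ((H s t)\<^sup>2) \<partial>lebesgue_on T)"
      using that by (intro nn_integral_mono pointwise) auto
    also have "\<dots> \<le> ?k * (\<integral>\<^sup>+ t. ennreal ((H s t)\<^sup>2) \<partial>lebesgue_on T)"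
      by (rule nn_integral_cmult_le[OF k])
    finally show ?thesis .
  qed
  have "(\<integral>\<^sup>+ s. (\<integral>\<^sup>+ t. ennreal ((G s t)\<^sup>2) \<partial>lebesgue_on T) \<partial>lebesgue_on S)
      \<le> (\<integral>\<^sup>+ s. ?k * (\<integral>\<^sup>+ t. ennreal ((H s t)\<^sup>2) \<partial>lebesgue_on T) \<partial>lebesgue_on S)"
    by (intro nn_integral_mono inner) auto
  also have "\<dots> \<le> ?k * (\<integral>\<^sup>+ s. (\<integral>\<^sup>+ t. ennreal ((H s t)\<^sup>2) \<partial>lebesgue_on T) \<partial>lebesgue_on S)"
    by (rule nn_integral_cmult_le[OF k])
  also have "\<dots> < \<infinity>"
    using H unfolding kernel_norm_finite_iff by (simp add: ennreal_mult_less_top)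
  finally show ?thesis
    unfolding kernel_norm_finite_iff .
qed

theorem theorem3p1:
  fixes \<Omega>\<^sub>s :: "'a::euclidean_space set"
    and \<Omega>\<^sub>t :: "'b::euclidean_space set"
    and H :: "'a \<Rightarrow> 'b \<Rightarrow> real"
    and c :: "'a \<Rightarrow> real"
    and l :: "'b \<Rightarrow> real"
    and c\<^sub>0 l\<^sub>0 :: real
  assumes "\<Omega>\<^sub>s \<in> sets lebesgue"
    and "\<Omega>\<^sub>t \<in> sets lebesgue"
    and "square_integrable_kernel \<Omega>\<^sub>s \<Omega>\<^sub>t H"
    and "c \<in> borel_measurable (lebesgue_on \<Omega>\<^sub>s)"
    and "l \<in> borel_measurable (lebesgue_on \<Omega>\<^sub>t)"
    and "bounded (c ` \<Omega>\<^sub>s)"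
    and "bounded (l ` \<Omega>\<^sub>t)"
    and "c\<^sub>0 > 0"
    and "l\<^sub>0 > 0"
    and "\<forall>s\<in>\<Omega>\<^sub>s. c s > c\<^sub>0"
    and "\<forall>t\<in>\<Omega>\<^sub>t. \<bar>l t\<bar> > l\<^sub>0"
  shows "square_integrable_kernel \<Omega>\<^sub>s \<Omega>\<^sub>t (\<lambda>s t. H s t / (c s * l t))"
proof -
  note [measurable] = assms(4,5)
  have H_measurable [measurable]:
    "(\<lambda>p. H (fst p) (snd p)) \<in> borel_measurable (lebesgue_on (\<Omega>\<^sub>s \<times> \<Omega>\<^sub>t))"
    using assms(3) by (simp add: square_integrable_kernel_def case_prod_beta')
  have H_norm: "kernel_norm \<Omega>\<^sub>s \<Omega>\<^sub>t H < \<infinity>"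
    using assms(3) by (simp add: square_integrable_kernel_def)

  have [measurable]: "fst \<in> measurable (lebesgue_on (\<Omega>\<^sub>s \<times> \<Omega>\<^sub>t)) (lebesgue_on \<Omega>\<^sub>s)"
    by (rule measurable_restrict_space3[OF lebesgue_measurable_fst]) auto
  have [measurable]: "snd \<in> measurable (lebesgue_on (\<Omega>\<^sub>s \<times> \<Omega>\<^sub>t)) (lebesgue_on \<Omega>\<^sub>t)"
    by (rule measurable_restrict_space3[OF lebesgue_measurable_snd]) auto
  have measurable:
    "(\<lambda>(s, t). H s t / (c s * l t)) \<in> borel_measurable (lebesgue_on (\<Omega>\<^sub>s \<times> \<Omega>\<^sub>t))"
    unfolding case_prod_beta' by measurable

  have bound: "\<bar>H s t / (c s * l t)\<bar> \<le> 1 / (c\<^sub>0 * l\<^sub>0) * \<bar>H s t\<bar>"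
    if "s \<in> \<Omega>\<^sub>s" "t \<in> \<Omega>\<^sub>t" for s t
  proof -
    have "c\<^sub>0 < c s" "l\<^sub>0 < \<bar>l t\<bar>"
      using that assms(10,11) by auto
    then have "c\<^sub>0 * l\<^sub>0 \<le> \<bar>c s * l t\<bar>"
      using assms(8,9) by (auto simp: abs_mult intro!: mult_mono)
    moreover have "0 < c\<^sub>0 * l\<^sub>0"
      using assms(8,9) by simp
    ultimately have "\<bar>H s t\<bar> / \<bar>c s * l t\<bar> \<le> \<bar>H s t\<bar> / (c\<^sub>0 * l\<^sub>0)"
      by (intro frac_le) auto
    then show ?thesis
      by simp
  qed
  have "kernel_norm \<Omega>\<^sub>s \<Omega>\<^sub>t (\<lambda>s t. H s t / (c s * l t)) < \<infinity>"
    by (rule kernel_norm_finite_dominated[OF H_norm _ bound]) (use assms(8,9) in auto)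
  with measurable show ?thesis
    by (simp add: square_integrable_kernel_def)
qed

end
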